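(* Let $(A_m)_{m\ge 0}$ be a sequence of real numbers such that $\sum_{m\ge 0}\frac{A_m}{m!}x^m$ converges for every real $x$, and put $f(x)=e^{-x}\sum_{m=0}^{\infty}\frac{A_m}{m!}x^m$. Then for all integers $N\ge0$, all $R>0$ and all integers $n\ge2$, \[ \left|f(R)-\sum_{m=0}^{N}\frac{\Delta^mA_n}{m!}(-R)^mC_m(-R,-n)\right|\le 3(N+1)\,n!\,\frac{e^R}{R^n}\,E(f^{(N+1)};R)\,n^{N/2}\,e^{\frac{|R-n|}{\sqrt n}}. \]
   Context: $\Delta A_m=A_{m+1}-A_m$, $\Delta^k$ its $k$-fold iterate, and $E(f^{(k)};r)=e^{-r}\sum_{m=0}^\infty\frac{|\Delta^kA_m|}{m!}r^m$. For real $\lambda,x$ and integer $m\ge0$, $\lambda^mC_m(\lambda,x)$ denotes the polynomial $\sum_{j=0}^{m}(-1)^{m-j}\binom mj\,x(x-1)\cdots(x-j+1)\,\lambda^{m-j}$ (Charlier polynomials, with generating function $\sum_m C_m(\lambda,x)w^m/m!=e^{-w}(1+w/\lambda)^x$). *)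

theory Defs
  imports Complex_Main
begin

definition fwd_diff :: "(nat \<Rightarrow> real) \<Rightarrow> nat \<Rightarrow> real" where
  "fwd_diff A m = A (Suc m) - A m"

definition borel_mean :: "(nat \<Rightarrow> real) \<Rightarrow> real \<Rightarrow> real" where
  "borel_mean A x = exp (- x) * (\<Sum>m. A m / fact m * x ^ m)"

(* E(f^(k); r) for f = borel_mean A: if the series converges everywhere, the k-th derivative of borel_mean A is
   borel_mean ((fwd_diff ^^ k) A), so this is the same mean formed with absolute values. *)
definition abs_mean_deriv :: "(nat \<Rightarrow> real) \<Rightarrow> nat \<Rightarrow> real \<Rightarrow> real" where
  "abs_mean_deriv A k r = exp (- r) * (\<Sum>m. \<bar>(fwd_diff ^^ k) A m\<bar> / fact m * r ^ m)"

(* C_m(l, x), where the product is the falling factorial x (x - 1) ... (x - j + 1).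
   Only meaningful for l \<noteq> 0; the polynomial form of l^m C_m(l, x) is the lemma below. *)
definition charlier :: "nat \<Rightarrow> real \<Rightarrow> real \<Rightarrow> real" where
  "charlier m l x =
     (\<Sum>j\<le>m. (-1) ^ (m - j) * real (m choose j) * (\<Prod>i<j. x - real i) / l ^ j)"

lemma power_mult_charlier:
  assumes "l \<noteq> 0"
  shows "l ^ m * charlier m l x =
     (\<Sum>j\<le>m. (-1) ^ (m - j) * real (m choose j) * (\<Prod>i<j. x - real i) * l ^ (m - j))"
  using assms unfolding charlier_def sum_distrib_left
  by (intro sum.cong) (auto simp: power_diff)

end

theory Submission imports Defs "HOL-Computational_Algebra.Formal_Power_Series"
begin

text \<open>For \<open>X\<close> Poisson distributed with mean \<open>R\<close>, \<open>f R\<close> is the expectation of \<open>A\<^sub>X\<close>, and the Charlier term of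
  index \<open>k\<close> is the expectation of the Newton term \<open>(X - n gchoose k) \<Delta>\<^sup>k A\<^sub>n\<close>. So the left-hand side is
  the expectation of the remainder of the Newton expansion at \<open>n\<close>, which is a sum of the
  \<open>(X - j - 1 gchoose N) \<Delta>\<^sup>N\<^sup>+\<^sup>1 A\<^sub>j\<close> over the \<open>j\<close> between \<open>n\<close> and \<open>X\<close>. After exchanging the summations, the weight of
  \<open>\<Delta>\<^sup>N\<^sup>+\<^sup>1 A\<^sub>j\<close> is estimated by an exponential moment of \<open>X\<close>: a single term of the binomial theorem gives
  \<open>(i choose N) u\<^sup>N \<le> (1 + u)\<^sup>i\<close> and \<open>(i + N choose N) u\<^sup>N (1 - u)\<^sup>i \<le> 1\<close>, used with \<open>u = 1 / \<surd>n\<close>.\<close>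

section \<open>Everywhere convergence of the difference series\<close>

lemma summable_fwd_diff:
  assumes "\<And>x::real. summable (\<lambda>m. A m / fact m * x ^ m)"
  shows "summable (\<lambda>m. fwd_diff A m / fact m * x ^ m)"
proof -
  \<comment> \<open>The series of the shifted sequence is the formal derivative of the given one, so
    it also converges everywhere.\<close>
  have "summable (\<lambda>m. diffs (\<lambda>m. A m / fact m) m * x ^ m)"
    by (rule termdiff_converges_all) (rule assms)
  moreover have "diffs (\<lambda>m. A m / fact m) m = A (Suc m) / fact m" for m
    by (simp add: diffs_def fact_Suc field_simps del: of_nat_Suc)
  ultimately have "summable (\<lambda>m. A (Suc m) / fact m * x ^ m)" by simp
  from summable_diff[OF this assms[of x]] show ?thesis
    by (simp add: fwd_diff_def field_simps)
qed

lemma summable_fwd_diff_iterate: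
  assumes "\<And>x::real. summable (\<lambda>m. A m / fact m * x ^ m)"
  shows "summable (\<lambda>m. (fwd_diff ^^ k) A m / fact m * x ^ m)"
proof (induction k arbitrary: x)
  case 0
  show ?case using assms by simp
next
  case (Suc k)
  from summable_fwd_diff[OF Suc] show ?case by simp
qed

lemma summable_abs_fwd_diff_iterate:
  assumes "\<And>x::real. summable (\<lambda>m. A m / fact m * x ^ m)" and "r \<ge> 0"
  shows "summable (\<lambda>m. \<bar>(fwd_diff ^^ k) A m\<bar> / fact m * r ^ m)"
proof -
  have "summable (\<lambda>m. norm ((fwd_diff ^^ k) A m / fact m * r ^ m))"
    \<comment> \<open>Convergence at the larger point \<open>r + 1\<close> yields absolute
      convergence at \<open>r\<close>.\<close>
    by (rule powser_insidea[OF summable_fwd_diff_iterate[OF assms(1), of k "r + 1"]])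
       (use assms(2) in simp)
  with assms(2) show ?thesis by (simp add: abs_mult)
qed

section \<open>Newton interpolation with a movable base point\<close>

text \<open>This is Newton's forward interpolation polynomial for the nodes
  \<open>a, ..., a + N\<close>.\<close>

definition newton_sum :: "(nat \<Rightarrow> real) \<Rightarrow> nat \<Rightarrow> real \<Rightarrow> nat \<Rightarrow> real" where
  "newton_sum A N x a = (\<Sum>k\<le>N. ((x - real a) gchoose k) * (fwd_diff ^^ k) A a)"

text \<open>Both interpolation polynomials share the nodes \<open>a + 1, ..., a + N\<close>, so they
  differ by a multiple of the binomial polynomial vanishing there. The induction obtains this from
  Pascal's rule.\<close>

lemma newton_sum_base_step:
  "newton_sum A N x (Suc a) - newton_sum A N x a
     = ((x - real a - 1) gchoose N) * (fwd_diff ^^ Suc N) A a"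
proof (induction N)
  case 0
  show ?case by (simp add: newton_sum_def fwd_diff_def)
next
  case (Suc N)
  define y where "y = x - real a - 1"
  have y: "x - real (Suc a) = y" "x - real a = y + 1" by (simp_all add: y_def)
  have "newton_sum A (Suc N) x (Suc a) - newton_sum A (Suc N) x a
      = (y gchoose N) * (fwd_diff ^^ Suc N) A a + (y gchoose Suc N) * (fwd_diff ^^ Suc N) A (Suc a)
        - ((y + 1) gchoose Suc N) * (fwd_diff ^^ Suc N) A a"
    using Suc by (simp add: newton_sum_def y del: funpow.simps of_nat_Suc)
  also have "\<dots> = (y gchoose Suc N) * ((fwd_diff ^^ Suc N) A (Suc a) - (fwd_diff ^^ Suc N) A a)"
    unfolding gbinomial_Suc_Suc by (simp add: algebra_simps del: funpow.simps)
  also have "(fwd_diff ^^ Suc N) A (Suc a) - (fwd_diff ^^ Suc N) A a = (fwd_diff ^^ Suc (Suc N)) A a"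
    by (simp add: fwd_diff_def)
  finally show ?case by (simp add: y_def del: funpow.simps)
qed

lemma newton_sum_at_base: "newton_sum A N (real m) m = A m"
proof -
  have "newton_sum A N (real m) m = (\<Sum>k\<le>N. if k = 0 then A m else 0)"
    unfolding newton_sum_def by (intro sum.cong) (auto simp: gbinomial_0_left)
  thus ?thesis by simp
qed

text \<open>At base \<open>m\<close> the Newton sum is \<open>A m\<close>, so the remainder
  telescopes while the base moves from \<open>n\<close> to \<open>m\<close>. At most one of the two
  intervals is nonempty; their union covers both directions.\<close>

lemma abs_newton_remainder_le:
  "\<bar>A m - newton_sum A N (real m) n\<bar>
     \<le> (\<Sum>j\<in>{n..<m} \<union> {m..<n}. \<bar>(real m - real j - 1) gchoose N\<bar> * \<bar>(fwd_diff ^^ Suc N) A j\<bar>)"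
proof -
  let ?T = "newton_sum A N (real m)"
  let ?g = "\<lambda>j. ((real m - real j - 1) gchoose N) * (fwd_diff ^^ Suc N) A j"
  have tele: "?T b - ?T a = (\<Sum>j\<in>{a..<b}. ?g j)" if "a \<le> b" for a b
    using sum_Suc_diff'[OF that, of ?T] by (simp add: newton_sum_base_step del: funpow.simps)
  have "\<bar>?T m - ?T n\<bar> = \<bar>\<Sum>j\<in>{n..<m} \<union> {m..<n}. ?g j\<bar>"
  proof (cases "n \<le> m")
    case True
    with tele[OF True] show ?thesis by simp
  next
    case False
    with tele[of m n] show ?thesis by (simp add: abs_minus_commute)
  qed
  also have "\<dots> \<le> (\<Sum>j\<in>{n..<m} \<union> {m..<n}. \<bar>?g j\<bar>)" by (rule sum_abs)
  finally show ?thesis by (simp add: newton_sum_at_base abs_mult)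
qed

section \<open>Poisson binomial moments and Charlier polynomials\<close>

text \<open>The terms with \<open>m < i\<close> vanish, and shifting the index by \<open>i\<close>
  leaves a multiple of the exponential series.\<close>

lemma binomial_moment_sums:
  "(\<lambda>m. R ^ m / fact m * (real m gchoose i)) sums (R ^ i / fact i * exp R)" for R :: real
proof -
  let ?F = "\<lambda>m. R ^ m / fact m * (real m gchoose i)"
  have shift: "?F (m + i) = R ^ i / fact i * (R ^ m / fact m)" for m
    unfolding binomial_gbinomial[symmetric]
    by (simp add: binomial_fact power_add field_simps del: of_nat_add)
  have "(\<lambda>m. R ^ m / fact m) sums exp R"
    using exp_converges[of R] by (simp add: field_simps)
  hence "(\<lambda>m. ?F (m + i)) sums (R ^ i / fact i * exp R)"
    unfolding shift by (rule sums_mult)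
  moreover have "(\<Sum>m<i. ?F m) = 0"
    by (intro sum.neutral) (simp add: binomial_gbinomial[symmetric])
  ultimately show ?thesis by (subst (asm) sums_iff_shift) simp
qed

text \<open>Vandermonde's identity for \<open>- n + m\<close> reduces the claim to the binomial
  moments.\<close>

lemma charlier_moment_sums:
  fixes R :: real
  assumes "R > 0"
  shows "(\<lambda>m. R ^ m / fact m * ((real m - real n) gchoose k))
           sums (exp R * ((- R) ^ k * charlier k (- R) (- real n) / fact k))"
proof -
  have "(\<lambda>m. \<Sum>j\<le>k. ((- real n) gchoose j) * (R ^ m / fact m * (real m gchoose (k - j))))
          sums (\<Sum>j\<le>k. ((- real n) gchoose j) * (R ^ (k - j) / fact (k - j) * exp R))"
    by (intro sums_sum sums_mult binomial_moment_sums)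
  moreover have "(\<Sum>j\<le>k. ((- real n) gchoose j) * (R ^ m / fact m * (real m gchoose (k - j))))
      = R ^ m / fact m * ((real m - real n) gchoose k)" for m
    using gbinomial_Vandermonde[of "- real n" "real m" k, symmetric]
    by (simp add: sum_distrib_left sum_divide_distrib mult_ac atLeast0AtMost)
  moreover have "(\<Sum>j\<le>k. ((- real n) gchoose j) * (R ^ (k - j) / fact (k - j) * exp R))
      = exp R * ((- R) ^ k * charlier k (- R) (- real n) / fact k)"
  proof -
    have "((- real n) gchoose j) * (R ^ (k - j) / fact (k - j) * exp R)
       = exp R / fact k * ((- 1) ^ (k - j) * real (k choose j) * (\<Prod>i<j. - real n - real i) * (- R) ^ (k - j))"
      if "j \<le> k" for j
    proof -
      \<comment> \<open>The sign of \<open>(- R) ^ (k - j)\<close> cancels the alternating sign of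
        the Charlier polynomial.\<close>
      have sign: "(- 1) ^ (k - j) * real (k choose j) * (\<Prod>i<j. - real n - real i) * (- R) ^ (k - j)
          = real (k choose j) * (\<Prod>i<j. - real n - real i) * R ^ (k - j)"
        by (subst power_minus) (simp add: mult_ac)
      show ?thesis
        unfolding sign
        using that by (simp add: binomial_fact gbinomial_prod_rev field_simps lessThan_atLeast0)
    qed
    moreover have "- R \<noteq> 0" using assms by simp
    ultimately show ?thesis
      by (simp add: power_mult_charlier sum_distrib_left sum_divide_distrib)
  qed
  ultimately show ?thesis by simp
qed

section \<open>Factorial and binomial inequalities\<close>

text \<open>This is log-convexity of the factorial: of two pairs with equal sum, the more spread one
  has the larger product.\<close>

lemma fact_mult_fact_le:
  "fact (a + p) * fact (a + q) \<le> (fact a * fact (a + p + q) :: real)"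
proof (induction p)
  case 0
  show ?case by simp
next
  case (Suc p)
  have "fact (a + Suc p) * fact (a + q) = real (Suc (a + p)) * (fact (a + p) * fact (a + q))"
    by (simp add: algebra_simps)
  also have "\<dots> \<le> real (Suc (a + p + q)) * (fact a * fact (a + p + q))"
    by (intro mult_mono Suc) auto
  also have "\<dots> = fact a * fact (a + Suc p + q)"
    by (simp add: algebra_simps)
  finally show ?case .
qed

lemma binomial_term_le:
  fixes x y :: real
  assumes "x \<ge> 0" "y \<ge> 0" "k \<le> n"
  shows "real (n choose k) * x ^ k * y ^ (n - k) \<le> (x + y) ^ n"
  unfolding binomial_ring by (rule member_le_sum) (use assms in auto)

lemma gchoose_kernel_above:
  fixes u :: real
  assumes "u > 0" "j < m"
  shows "\<bar>(real m - real j - 1) gchoose N\<bar> * u ^ N \<le> (1 + u) ^ (m - j)"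
proof -
  define i where "i = m - j - 1"
  have i: "real m - real j - 1 = real i" using assms by (simp add: i_def of_nat_diff)
  have "real (i choose N) * u ^ N \<le> (1 + u) ^ i"
  proof (cases "N \<le> i")
    case True
    from binomial_term_le[of u 1, OF _ _ this] assms show ?thesis by (simp add: add.commute)
  next
    case False
    with assms show ?thesis by (simp add: binomial_eq_0)
  qed
  \<comment> \<open>The exponent \<open>m - j - 1\<close> is raised by one at no cost, to depend
    only on the distance of \<open>m\<close> and \<open>j\<close>.\<close>
  also have "\<dots> \<le> (1 + u) ^ (m - j)"
    by (intro power_increasing) (use assms in \<open>auto simp: i_def\<close>)
  finally show ?thesis by (simp add: i flip: binomial_gbinomial)
qed

text \<open>The upper index is negative here. Reflection gives \<open>(i + N) choose N\<close> up to
  sign, with \<open>i = j - m\<close>, and the claim bounds one term of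
  \<open>(u + (1 - u)) ^ (i + N) = 1\<close>.\<close>

lemma gchoose_kernel_below:
  fixes u :: real
  assumes "u > 0" "u < 1" "m \<le> j"
  shows "\<bar>(real m - real j - 1) gchoose N\<bar> * u ^ N * (1 - u) ^ (j - m) \<le> 1"
proof -
  define i where "i = j - m"
  have i: "real m - real j - 1 = - (real i + 1)" using assms by (simp add: i_def of_nat_diff)
  have "((- (real i + 1)) gchoose N) = (- 1) ^ N * real ((i + N) choose N)"
    unfolding binomial_gbinomial by (subst gbinomial_minus) (simp add: add.commute)
  hence "\<bar>(real m - real j - 1) gchoose N\<bar> = real ((i + N) choose N)"
    unfolding i binomial_gbinomial[symmetric] of_nat_add[symmetric]
    by (simp add: abs_mult power_abs)
  with binomial_term_le[of u "1 - u" N "i + N"] assms show ?thesis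
    by (simp add: i_def)
qed

section \<open>Exponential and logarithmic estimates\<close>

lemma exp_partial_sum_le:
  fixes x :: real
  assumes "x \<ge> 0" "finite S"
  shows "(\<Sum>l\<in>S. x ^ l / fact l) \<le> exp x"
proof -
  have "(\<lambda>l. x ^ l / fact l) sums exp x"
    using exp_converges[of x] by (simp add: field_simps)
  moreover from this have "(\<Sum>l\<in>S. x ^ l / fact l) \<le> (\<Sum>l. x ^ l / fact l)"
    using assms by (intro sum_le_suminf) (auto simp: sums_iff)
  ultimately show ?thesis by (simp add: sums_iff)
qed

text \<open>The difference of the sides vanishes at 0 and has derivative
  \<open>t * (1 - 2 * t) / (1 - t)\<close>, whose sign dictates the bound
  \<open>1 / 2\<close>.\<close>

lemma ln_one_minus_ge:
  fixes x :: real
  assumes "0 \<le> x" "x \<le> 1 / 2"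
  shows "- x - x\<^sup>2 \<le> ln (1 - x)"
proof -
  let ?g = "\<lambda>t::real. ln (1 - t) + t + t\<^sup>2"
  have "?g 0 \<le> ?g x"
  proof (rule DERIV_nonneg_imp_nondecreasing[OF assms(1)])
    fix t assume t: "0 \<le> t" "t \<le> x"
    have "(?g has_real_derivative (- 1 / (1 - t) + 1 + 2 * t)) (at t)"
      using t assms by (auto intro!: derivative_eq_intros)
    moreover have "- 1 / (1 - t) + 1 + 2 * t = t * (1 - 2 * t) / (1 - t)"
      using t assms by (simp add: field_simps)
    moreover have "\<dots> \<ge> 0" using t assms by simp
    ultimately show "\<exists>y. (?g has_real_derivative y) (at t) \<and> y \<ge> 0" by metis
  qed
  thus ?thesis by simp
qed

text \<open>For \<open>n >= 4\<close> the logarithmic bound applies and loses only a factor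
  \<open>exp 1 <= 3\<close>. For \<open>n = 2\<close> and \<open>n = 3\<close> the argument
  \<open>1 / sqrt n\<close> exceeds \<open>1 / 2\<close>, so these cases are numerical.\<close>

lemma one_minus_inverse_sqrt_power_ge:
  assumes "n \<ge> 2"
  shows "exp (- sqrt (real n)) \<le> 3 * (1 - 1 / sqrt (real n)) ^ n"
proof -
  consider "n = 2" | "n = 3" | "n \<ge> 4" using assms by linarith
  thus ?thesis
  proof cases
    case 1
    have s: "(1.414::real) \<le> sqrt 2" "sqrt 2 \<le> (1.415::real)"
      by (rule real_le_rsqrt real_le_lsqrt; simp add: power2_eq_square)+
    \<comment> \<open>The value 3.95 suffices because \<open>3.95 * 3 * (3 / 2 - 1.415)\<close>
      exceeds 1, though barely.\<close>
    have "(3.95::real) \<le> (\<Sum>k<5. 1.414 ^ k / fact k)"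
      by (simp add: eval_nat_numeral)
    also have "\<dots> \<le> exp 1.414" by (rule exp_partial_sum_le) auto
    also have "\<dots> \<le> exp (sqrt 2)" using s by simp
    finally have e: "3.95 \<le> exp (sqrt 2)" .
    have "3 * (1 - 1 / sqrt 2) ^ 2 = 3 * (3 / 2 - sqrt (2::real))"
      by (simp add: power2_eq_square field_simps)
    moreover have "3.95 * (3 * (3 / 2 - sqrt 2)) \<le> exp (sqrt 2) * (3 * (3 / 2 - sqrt (2::real)))"
      by (rule mult_right_mono[OF e]) (use s in simp)
    ultimately have "1 \<le> exp (sqrt 2) * (3 * (1 - 1 / sqrt 2) ^ 2)" using s by simp
    thus ?thesis using 1 by (simp add: exp_minus field_simps)
  next
    case 2
    have s: "(1.73::real) \<le> sqrt 3" "sqrt 3 \<le> (1.733::real)"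
      by (rule real_le_rsqrt real_le_lsqrt; simp add: power2_eq_square)+
    \<comment> \<open>Likewise \<open>4.5 * (6 - 10 * 1.733 / 3)\<close> exceeds 1.\<close>
    have "(4.5::real) \<le> (\<Sum>k<5. 1.73 ^ k / fact k)"
      by (simp add: eval_nat_numeral)
    also have "\<dots> \<le> exp 1.73" by (rule exp_partial_sum_le) auto
    also have "\<dots> \<le> exp (sqrt 3)" using s by simp
    finally have e: "4.5 \<le> exp (sqrt 3)" .
    have "3 * (1 - 1 / sqrt 3) ^ 3 = 6 - 10 * sqrt (3::real) / 3"
      by (simp add: power3_eq_cube field_simps)
    moreover have "4.5 * (6 - 10 * sqrt 3 / 3) \<le> exp (sqrt 3) * (6 - 10 * sqrt (3::real) / 3)"
      by (rule mult_right_mono[OF e]) (use s in simp)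
    ultimately have "1 \<le> exp (sqrt 3) * (3 * (1 - 1 / sqrt 3) ^ 3)" using s by simp
    thus ?thesis using 2 by (simp add: exp_minus field_simps)
  next
    case 3
    have u: "1 / sqrt (real n) \<le> 1 / 2"
      using real_le_rsqrt[of 2 "real n"] 3 by (simp add: field_simps)
    have "- sqrt (real n) - 1 = real n * (- (1 / sqrt (real n)) - (1 / sqrt (real n))\<^sup>2)"
      using 3 by (simp add: power_divide field_simps real_div_sqrt)
    also have "\<dots> \<le> real n * ln (1 - 1 / sqrt (real n))"
      using ln_one_minus_ge[OF _ u] by (intro mult_left_mono) auto
    finally have "exp (- sqrt (real n) - 1) \<le> exp (real n * ln (1 - 1 / sqrt (real n)))" by simp
    also have "\<dots> = (1 - 1 / sqrt (real n)) ^ n"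
      using u by (simp add: exp_of_nat_mult)
    finally have "exp (- sqrt (real n)) \<le> exp 1 * (1 - 1 / sqrt (real n)) ^ n"
      by (simp add: exp_diff field_simps)
    also have "\<dots> \<le> 3 * (1 - 1 / sqrt (real n)) ^ n"
      by (intro mult_right_mono exp_le) (use u in simp)
    finally show ?thesis .
  qed
qed

lemma one_plus_inverse_sqrt_power_ge:
  assumes "n \<ge> 1"
  shows "exp (sqrt (real n)) \<le> 3 * (1 + 1 / sqrt (real n)) ^ n"
proof -
  have "sqrt (real n) - 1 = real n * (1 / sqrt (real n) - (1 / sqrt (real n))\<^sup>2)"
    using assms by (simp add: power_divide field_simps real_div_sqrt)
  also have "\<dots> \<le> real n * ln (1 + 1 / sqrt (real n))"
    by (intro mult_left_mono ln_one_plus_pos_lower_bound) (use assms in auto)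
  finally have "exp (sqrt (real n) - 1) \<le> exp (real n * ln (1 + 1 / sqrt (real n)))" by simp
  also have "\<dots> = (1 + 1 / sqrt (real n)) ^ n"
    by (simp add: exp_of_nat_mult add_pos_nonneg)
  finally have "exp (sqrt (real n)) \<le> exp 1 * (1 + 1 / sqrt (real n)) ^ n"
    by (simp add: exp_diff field_simps)
  also have "\<dots> \<le> 3 * (1 + 1 / sqrt (real n)) ^ n"
    by (intro mult_right_mono exp_le) simp
  finally show ?thesis .
qed

section \<open>Weight of a single difference\<close>

text \<open>Since \<open>R\<^sup>m / m!\<close> is log-concave in \<open>m\<close>, the ratio of its values at \<open>m\<close> and \<open>j\<close> is at most the ratio
  at \<open>m + n - j\<close> and \<open>n\<close>: the case \<open>j = n\<close> is the worst one.\<close>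

lemma kernel_sum_le:
  fixes R z v :: real
  assumes "R > 0" "z > 0" "v \<ge> 0" "finite S"
    and between: "\<And>m. m \<in> S \<Longrightarrow> n \<le> j \<and> j \<le> m \<or> m \<le> j \<and> j \<le> n"
    and kernel: "\<And>m. m \<in> S \<Longrightarrow> 0 \<le> L m \<and> L m * z ^ n \<le> v * z ^ (m + n - j)"
  shows "(\<Sum>m\<in>S. R ^ m / fact m * L m) \<le> R ^ j / fact j * (fact n / R ^ n * v * exp (R * z) / z ^ n)"
proof -
  let ?C = "R ^ j / fact j * (fact n / R ^ n * v / z ^ n)"
  have C: "?C \<ge> 0" using assms by simp
  have summand: "R ^ m / fact m * L m \<le> ?C * ((R * z) ^ (m + n - j) / fact (m + n - j))"
    if m: "m \<in> S" for m
  proof -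
    \<comment> \<open>The natural number \<open>l\<close> represents \<open>n + (m - j)\<close> even
      when \<open>m < j\<close>; no truncation occurs, since \<open>j\<close> is at most
      \<open>m\<close> or at most \<open>n\<close>.\<close>
    define l where "l = m + n - j"
    have l: "m + n = j + l" using between[OF m] by (auto simp: l_def)
    \<comment> \<open>Both \<open>j\<close> and \<open>l\<close> lie between \<open>m\<close> and
      \<open>n\<close> and have the same sum, so log-convexity applies.\<close>
    have "fact j * fact l \<le> (fact m * fact n :: real)"
      using between[OF m]
    proof
      assume "n \<le> j \<and> j \<le> m"
      with fact_mult_fact_le[of n "j - n" "m - j"] l show ?thesis
        by (simp add: mult.commute add.commute)
    next
      assume "m \<le> j \<and> j \<le> n"
      with fact_mult_fact_le[of m "j - m" "n - j"] l show ?thesis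
        by (simp add: mult.commute add.commute)
    qed
    hence f: "1 / fact m \<le> (fact n / (fact j * fact l) :: real)"
      by (simp add: field_simps)
    have L: "0 \<le> L m" "L m \<le> v * z ^ l / z ^ n"
      using kernel[OF m] assms by (auto simp: l_def field_simps)
    have "R ^ m = R ^ j * R ^ l / R ^ n"
      using assms(1) l by (simp add: field_simps flip: power_add)
    have "R ^ m / fact m * L m = R ^ m * (1 / fact m) * L m" by simp
    also have "\<dots> \<le> R ^ m * (fact n / (fact j * fact l)) * (v * z ^ l / z ^ n)"
      by (intro mult_mono mult_left_mono f L) (use assms in auto)
    also have "\<dots> = ?C * ((R * z) ^ l / fact l)"
      by (subst \<open>R ^ m = _\<close>) (simp add: power_mult_distrib mult_ac)
    finally show ?thesis by (simp add: l_def)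
  qed
  \<comment> \<open>Distinct \<open>m\<close> give distinct exponents, so the sum becomes part of
    the exponential series at \<open>R * z\<close>.\<close>
  have inj: "inj_on (\<lambda>m. m + n - j) S"
  proof (rule inj_onI)
    fix a b assume "a \<in> S" "b \<in> S" "a + n - j = b + n - j"
    with between[of a] between[of b] show "a = b" by auto
  qed
  have "(\<Sum>m\<in>S. R ^ m / fact m * L m)
      \<le> ?C * (\<Sum>m\<in>S. (R * z) ^ (m + n - j) / fact (m + n - j))"
    unfolding sum_distrib_left by (rule sum_mono) (rule summand)
  also have "(\<Sum>m\<in>S. (R * z) ^ (m + n - j) / fact (m + n - j))
      = (\<Sum>l\<in>(\<lambda>m. m + n - j) ` S. (R * z) ^ l / fact l)"
    by (simp add: sum.reindex[OF inj])
  also have "?C * \<dots> \<le> ?C * exp (R * z)"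
    by (intro mult_left_mono exp_partial_sum_le C) (use assms in auto)
  finally show ?thesis by (simp add: field_simps)
qed

text \<open>The preceding bound is used with \<open>z = 1 + u\<close> for \<open>j >= n\<close> and
  \<open>z = 1 - u\<close> for \<open>j < n\<close>, where \<open>u = 1 / sqrt n\<close>. The power
  of \<open>n\<close> compensates the factor \<open>u ^ N\<close> in the kernel bounds.\<close>

lemma gchoose_kernel_sum_le:
  fixes R :: real
  assumes R: "R > 0" and n: "n \<ge> 2" and S: "finite S"
    and between: "\<And>m. m \<in> S \<Longrightarrow> j \<in> {n..<m} \<union> {m..<n}"
  shows "(\<Sum>m\<in>S. R ^ m / fact m * \<bar>(real m - real j - 1) gchoose N\<bar>)
     \<le> R ^ j / fact j * (3 * (fact n * exp R / R ^ n) * real n powr (real N / 2)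
          * exp (\<bar>R - real n\<bar> / sqrt (real n)))"
    (is "?lhs \<le> R ^ j / fact j * ?B")
proof -
  define s u where "s = sqrt (real n)" and "u = 1 / s"
  define v where "v = real n powr (real N / 2)"
  have s: "s > 1" using n by (simp add: s_def)
  have u: "0 < u" "u < 1" using s by (simp_all add: u_def)
  have ss: "s * s = real n" by (simp add: s_def)
  have "v = s ^ N"
    using n by (simp add: v_def s_def powr_half_sqrt[symmetric] powr_powr flip: powr_realpow)
  hence v: "v * u ^ N = 1" "v > 0" using s by (simp_all add: u_def power_divide)
  have scaled: "x \<le> v * y" if "x * u ^ N \<le> y" for x y :: real
  proof -
    have "x = v * (x * u ^ N)" using v(1) by (simp add: mult.left_commute)
    also have "\<dots> \<le> v * y" using that v(2) by simp
    finally show ?thesis .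
  qed
  let ?G = "fact n / R ^ n * v"
  \<comment> \<open>The exponent \<open>e\<close> will be \<open>s\<close> or \<open>- s\<close>, so
    that \<open>exp e\<close> is comparable with \<open>z ^ n\<close>.\<close>
  have final: "R ^ j / fact j * (?G * exp (R * z) / z ^ n) \<le> R ^ j / fact j * ?B"
    if z: "z > 0" and b: "exp e \<le> 3 * z ^ n" and ez: "R * z - e \<le> R + \<bar>R - real n\<bar> / s" for z e
  proof -
    have "exp (R * z) / z ^ n = exp (R * z - e) * (exp e / z ^ n)" by (simp add: exp_diff)
    also have "\<dots> \<le> exp (R + \<bar>R - real n\<bar> / s) * 3"
      by (intro mult_mono) (use z b ez in \<open>auto simp: field_simps\<close>)
    finally have "?G * (exp (R * z) / z ^ n) \<le> ?G * (exp (R + \<bar>R - real n\<bar> / s) * 3)"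
      by (rule mult_left_mono) (use v R in simp)
    also have "\<dots> = ?B" by (simp add: exp_add v_def s_def)
    finally show ?thesis using R by (intro mult_left_mono) simp_all
  qed
  show ?thesis
  proof (cases "n \<le> j")
    case True
    have jm: "j < m" if "m \<in> S" for m using between[OF that] True by auto
    have "?lhs \<le> R ^ j / fact j * (?G * exp (R * (1 + u)) / (1 + u) ^ n)"
    proof (rule kernel_sum_le)
      fix m assume m: "m \<in> S"
      show "n \<le> j \<and> j \<le> m \<or> m \<le> j \<and> j \<le> n" using True jm[OF m] by simp
      have "\<bar>(real m - real j - 1) gchoose N\<bar> \<le> v * (1 + u) ^ (m - j)"
        by (intro scaled gchoose_kernel_above u jm m)
      hence "\<bar>(real m - real j - 1) gchoose N\<bar> * (1 + u) ^ n \<le> v * (1 + u) ^ (m - j) * (1 + u) ^ n"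
        by (rule mult_right_mono) (use u in simp)
      also have "\<dots> = v * (1 + u) ^ (m + n - j)"
        using jm[OF m] by (simp flip: power_add add: mult.assoc)
      finally show "0 \<le> \<bar>(real m - real j - 1) gchoose N\<bar> \<and>
        \<bar>(real m - real j - 1) gchoose N\<bar> * (1 + u) ^ n \<le> v * (1 + u) ^ (m + n - j)" by simp
    qed (use R u v S in auto)
    also have "\<dots> \<le> R ^ j / fact j * ?B"
    proof (rule final)
      show "exp s \<le> 3 * (1 + u) ^ n"
        using one_plus_inverse_sqrt_power_ge[of n] n by (simp add: u_def s_def)
      \<comment> \<open>As \<open>n = s * s\<close>, the excess \<open>R * u - s\<close> equals
        \<open>(R - n) / s\<close>.\<close>
      have "R * (1 + u) - s = R + (R - real n) / s"
        using s ss by (simp add: u_def field_simps)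
      also have "\<dots> \<le> R + \<bar>R - real n\<bar> / s" using s by (simp add: divide_right_mono)
      finally show "R * (1 + u) - s \<le> R + \<bar>R - real n\<bar> / s" .
    qed (use u in simp)
    finally show ?thesis .
  next
    case False
    have mj: "m \<le> j" if "m \<in> S" for m using between[OF that] False by auto
    have "?lhs \<le> R ^ j / fact j * (?G * exp (R * (1 - u)) / (1 - u) ^ n)"
    proof (rule kernel_sum_le)
      fix m assume m: "m \<in> S"
      show "n \<le> j \<and> j \<le> m \<or> m \<le> j \<and> j \<le> n" using False mj[OF m] by simp
      have "\<bar>(real m - real j - 1) gchoose N\<bar> * (1 - u) ^ (j - m) \<le> v * 1"
        using gchoose_kernel_below[OF u mj[OF m], of N] by (intro scaled) (simp add: mult_ac)
      hence "\<bar>(real m - real j - 1) gchoose N\<bar> * (1 - u) ^ (j - m) * (1 - u) ^ (m + n - j)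
          \<le> v * 1 * (1 - u) ^ (m + n - j)"
        by (rule mult_right_mono) (use u in simp)
      moreover have "(1 - u) ^ (j - m) * (1 - u) ^ (m + n - j) = (1 - u) ^ n"
        using mj[OF m] False by (simp flip: power_add)
      ultimately show "0 \<le> \<bar>(real m - real j - 1) gchoose N\<bar> \<and>
        \<bar>(real m - real j - 1) gchoose N\<bar> * (1 - u) ^ n \<le> v * (1 - u) ^ (m + n - j)"
        by (simp add: mult.assoc)
    qed (use R u v S in auto)
    also have "\<dots> \<le> R ^ j / fact j * ?B"
    proof (rule final)
      show "exp (- s) \<le> 3 * (1 - u) ^ n"
        using one_minus_inverse_sqrt_power_ge[OF n] by (simp add: u_def s_def)
      have "R * (1 - u) - - s = R + - (R - real n) / s"
        using s ss by (simp add: u_def field_simps)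
      also have "\<dots> \<le> R + \<bar>R - real n\<bar> / s"
        using s by (intro add_left_mono divide_right_mono) auto
      finally show "R * (1 - u) - - s \<le> R + \<bar>R - real n\<bar> / s" .
    qed (use u in simp)
    finally show ?thesis .
  qed
qed

section \<open>Exchange of summations and passage to the limit\<close>

theorem theorem10:
  fixes A :: "nat \<Rightarrow> real" and f :: "real \<Rightarrow> real" and N n :: nat and R :: real
  assumes "\<And>x::real. summable (\<lambda>m. A m / fact m * x ^ m)"
    and "f = borel_mean A"
    and "R > 0" and "n \<ge> 2"
  shows "\<bar>f R - (\<Sum>m\<le>N. (fwd_diff ^^ m) A n / fact m * ((- R) ^ m * charlier m (- R) (- real n)))\<bar>
    \<le> 3 * (real N + 1) * fact n * (exp R / R ^ n) * abs_mean_deriv A (N + 1) R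
       * real n powr (real N / 2) * exp (\<bar>R - real n\<bar> / sqrt (real n))"
proof -
  define D where "D = (fwd_diff ^^ Suc N) A"
  define B where "B = 3 * (fact n * exp R / R ^ n) * real n powr (real N / 2)
          * exp (\<bar>R - real n\<bar> / sqrt (real n))"
  define E where "E = (\<Sum>m. \<bar>D m\<bar> / fact m * R ^ m)"
  define X where "X = f R - (\<Sum>m\<le>N. (fwd_diff ^^ m) A n / fact m * ((- R) ^ m * charlier m (- R) (- real n)))"
  define rem where "rem m = R ^ m / fact m * (A m - newton_sum A N (real m) n)" for m
  let ?L = "\<lambda>m j. \<bar>(real m - real j - 1) gchoose N\<bar>"
  let ?J = "\<lambda>m. {n..<m} \<union> {m..<n}"
  have B: "B \<ge> 0" using assms(3) by (simp add: B_def)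
  have sumD: "summable (\<lambda>m. \<bar>D m\<bar> / fact m * R ^ m)"
    unfolding D_def using assms(1,3) by (intro summable_abs_fwd_diff_iterate) auto
  have E: "E \<ge> 0" unfolding E_def using assms(3) by (intro suminf_nonneg sumD) auto

  have "(\<lambda>m. A m / fact m * R ^ m
           - (\<Sum>k\<le>N. (fwd_diff ^^ k) A n * (R ^ m / fact m * ((real m - real n) gchoose k))))
        sums ((\<Sum>m. A m / fact m * R ^ m)
           - (\<Sum>k\<le>N. (fwd_diff ^^ k) A n * (exp R * ((- R) ^ k * charlier k (- R) (- real n) / fact k))))"
    by (intro sums_diff summable_sums assms(1) sums_sum sums_mult charlier_moment_sums assms(3))
  also have "(\<Sum>m. A m / fact m * R ^ m) = exp R * f R"
    using assms(2) by (simp add: borel_mean_def exp_minus)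
  also have "exp R * f R - (\<Sum>k\<le>N. (fwd_diff ^^ k) A n * (exp R * ((- R) ^ k * charlier k (- R) (- real n) / fact k)))
      = exp R * X"
    by (simp add: X_def right_diff_distrib sum_distrib_left mult_ac)
  also have "(\<lambda>m. A m / fact m * R ^ m
           - (\<Sum>k\<le>N. (fwd_diff ^^ k) A n * (R ^ m / fact m * ((real m - real n) gchoose k)))) = rem"
    by (rule ext) (simp add: rem_def newton_sum_def right_diff_distrib sum_distrib_left mult_ac)
  finally have rem_sums: "rem sums (exp R * X)" .

  \<comment> \<open>A bound uniform in \<open>M\<close> on partial sums keeps the exchange of
    summations finite.\<close>
  have "\<bar>\<Sum>m<M. rem m\<bar> \<le> B * E" for M
  proof -
    have "\<bar>\<Sum>m<M. rem m\<bar> \<le> (\<Sum>m<M. \<bar>rem m\<bar>)" by (rule sum_abs)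
    also have "\<dots> \<le> (\<Sum>m<M. R ^ m / fact m * (\<Sum>j\<in>?J m. ?L m j * \<bar>D j\<bar>))"
    proof (rule sum_mono)
      fix m
      show "\<bar>rem m\<bar> \<le> R ^ m / fact m * (\<Sum>j\<in>?J m. ?L m j * \<bar>D j\<bar>)"
        using mult_left_mono[OF abs_newton_remainder_le[of A m N n], of "R ^ m / fact m"] assms(3)
        by (simp add: rem_def abs_mult D_def del: funpow.simps)
    qed
    also have "\<dots> = (\<Sum>m<M. \<Sum>j\<in>?J m. \<bar>D j\<bar> * (R ^ m / fact m * ?L m j))"
      by (simp add: sum_distrib_left mult_ac)
    \<comment> \<open>For \<open>m < M\<close> every \<open>j\<close> between \<open>m\<close> and
      \<open>n\<close> is below \<open>M + n\<close>; this common index range permits the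
      swap.\<close>
    also have "\<dots> = (\<Sum>m<M. \<Sum>j\<in>{j\<in>{..<M + n}. j \<in> ?J m}. \<bar>D j\<bar> * (R ^ m / fact m * ?L m j))"
      by (intro sum.cong) auto
    also have "\<dots> = (\<Sum>j<M + n. \<Sum>m\<in>{m\<in>{..<M}. j \<in> ?J m}. \<bar>D j\<bar> * (R ^ m / fact m * ?L m j))"
      by (rule sum.swap_restrict) auto
    also have "\<dots> \<le> (\<Sum>j<M + n. \<bar>D j\<bar> * (R ^ j / fact j * B))"
      unfolding sum_distrib_left[symmetric] B_def
      by (intro sum_mono mult_left_mono gchoose_kernel_sum_le assms(3,4)) auto
    also have "\<dots> = B * (\<Sum>j<M + n. \<bar>D j\<bar> / fact j * R ^ j)"
      by (simp add: sum_distrib_left mult_ac)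
    also have "\<dots> \<le> B * E"
      unfolding E_def using assms(3) by (intro mult_left_mono B sum_le_suminf sumD) auto
    finally show ?thesis .
  qed
  moreover have "(\<lambda>M. \<bar>\<Sum>m<M. rem m\<bar>) \<longlonglongrightarrow> \<bar>exp R * X\<bar>"
    using rem_sums unfolding sums_def by (rule tendsto_rabs)
  ultimately have "\<bar>exp R * X\<bar> \<le> B * E" by (intro LIMSEQ_le_const2) auto
  hence "\<bar>X\<bar> \<le> 1 * (B * (exp (- R) * E))"
    by (simp add: abs_mult exp_minus field_simps)
  \<comment> \<open>The factor 1 is relaxed to \<open>real N + 1\<close> to reach the stated
    constant.\<close>
  also have "\<dots> \<le> (real N + 1) * (B * (exp (- R) * E))"
    by (intro mult_right_mono) (use B E in auto)
  also have "exp (- R) * E = abs_mean_deriv A (N + 1) R"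
    by (simp add: abs_mean_deriv_def E_def D_def)
  also have "(real N + 1) * (B * abs_mean_deriv A (N + 1) R)
      = 3 * (real N + 1) * fact n * (exp R / R ^ n) * abs_mean_deriv A (N + 1) R
        * real n powr (real N / 2) * exp (\<bar>R - real n\<bar> / sqrt (real n))"
    by (simp add: B_def)
  finally show ?thesis unfolding X_def .
qed

end
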